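(* Let $\mathbb{F}$ be a field of characteristic $p>2$, let $\chi\in\mathfrak{sl}(2)^*$ with $\chi(e)=0$, let $\lambda\in\Lambda_\chi$, and let $\varphi$ be a 2-local derivation of $\mathfrak{sl}(2)$ on $L_\chi(\lambda)$. (1) If $(\chi,p,\lambda)\neq(0,3,1)$, then $\varphi$ is a derivation. (2) If $(\chi,p,\lambda)=(0,3,1)$, then there exist a derivation $D\in\mathrm{Der}(\mathfrak{sl}(2),L_\chi(\lambda))$ and two maps $m,n:\mathfrak{sl}(2)\to\mathbb{F}$ such that for every $x=x_ee+x_ff+x_hh\in\mathfrak{sl}(2)$ with $x_e,x_f,x_h\in\mathbb{F}$, $$\varphi(x)=D(x)+\begin{cases}0, & x_ex_f=0,\\ m(x)v_0+n(x)v_1, & x_ex_f\neq0.\end{cases}$$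
   Context: The underlying field $\mathbb{F}$ has characteristic $p>2$, and $\mathbb{F}_p\subseteq\mathbb{F}$ is its prime field. $\mathfrak{sl}(2)$ is the 3-dimensional simple Lie algebra over $\mathbb{F}$ of trace-zero $2\times 2$ matrices, with standard basis $h=\mathrm{diag}(1,-1)$, $e=E_{12}$, $f=E_{21}$. It is a restricted Lie algebra with $h^{[p]}=h$, $e^{[p]}=f^{[p]}=0$. Derivations: for a finite-dimensional Lie algebra $\mathfrak{g}$ and a finite-dimensional $\mathfrak{g}$-module $M$, a derivation of $\mathfrak{g}$ on $M$ is a linear map $\phi:\mathfrak{g}\to M$ with $\phi([x,y])=x\phi(y)-y\phi(x)$ for all $x,y\in\mathfrak{g}$; $\mathrm{Der}(\mathfrak{g},M)$ is the space of these. A 2-local derivation of $\mathfrak{g}$ on $M$ is a map $\varphi:\mathfrak{g}\to M$ (not assumed linear) such that for any $x,y\in\mathfrak{g}$ there exists $D_{x,y}\in\mathrm{Der}(\mathfrak{g},M)$ (depending on $x,y$) with $\varphi(x)=D_{x,y}(x)$ and $\varphi(y)=D_{x,y}(y)$. Modules: let $\chi\in\mathfrak{sl}(2)^*$ with $\chi(e)=0$. $U_\chi(\mathfrak{sl}(2))$ is the quotient of the universal enveloping algebra of $\mathfrak{sl}(2)$ by the two-sided ideal generated by all $x^p-x^{[p]}-\chi(x)^p$, $x\in\mathfrak{sl}(2)$; $U_\chi$ of a restricted subalgebra is defined likewise. Put $\Lambda_\chi=\{\lambda\in\mathbb{F}\mid \lambda^p-\lambda=\chi(h)^p\}$. For $\lambda\in\Lambda_\chi$,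 let $\mathbb{F}v$ be the 1-dimensional $U_\chi(\mathbb{F}h+\mathbb{F}e)$-module with $hv=\lambda v$, $ev=0$, and let $Z_\chi(\lambda)=U_\chi(\mathfrak{sl}(2))\otimes_{U_\chi(\mathbb{F}h+\mathbb{F}e)}\mathbb{F}v$, with basis $v_i=f^i\otimes v$, $0\le i\le p-1$. $L_\chi(\lambda)$ denotes the unique simple quotient of $Z_\chi(\lambda)$ (images of the $v_i$ are denoted by the same symbols). Explicitly: (1) If $\chi(h)\ne0$ or $\chi(f)\neq 0$, $L_\chi(\lambda)$ has basis $v_0,\dots,v_{p-1}$ with $ev_i=i(\lambda-i+1)v_{i-1}$, $hv_i=(\lambda-2i)v_i$, $fv_i=v_{i+1}$ for $i<p-1$, and $fv_{p-1}=\chi(f)^pv_0$. (2) If $\chi=0$ (so $\lambda\in\mathbb{F}_p$), let $\Phi(\lambda)\in\{0,1,\dots,p-1\}$ be the integer congruent to $\lambda$ mod $p$; $L_0(\lambda)$ has basis $v_0,\dots,v_{\Phi(\lambda)}$ with $ev_i=i(\lambda-i+1)v_{i-1}$, $hv_i=(\lambda-2i)v_i$, $fv_i=v_{i+1}$ for $i<\Phi(\lambda)$, and $fv_{\Phi(\lambda)}=0$. *)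

theory Defs
  imports "HOL-Analysis.Analysis" "HOL-Computational_Algebra.Polynomial"
begin

definition sl2 :: "('a::field ^ 2 ^ 2) set" where
  "sl2 = {A. trace A = 0}"

definition bracket :: "'a::field ^ 2 ^ 2 \<Rightarrow> 'a ^ 2 ^ 2 \<Rightarrow> 'a ^ 2 ^ 2" where
  "bracket A B = A ** B - B ** A"

text \<open>The library's \<open>*s\<close> scales vectors over \<open>'a\<close>, not matrices.\<close>

definition mscale :: "'a::field \<Rightarrow> 'a ^ 2 ^ 2 \<Rightarrow> 'a ^ 2 ^ 2" where
  "mscale c A = (\<chi> i j. c * A $ i $ j)"

definition sl2_h :: "'a::field ^ 2 ^ 2" where
  "sl2_h = (\<chi> i j. if i = j then (if i = 1 then 1 else - 1) else 0)"

definition sl2_e :: "'a::field ^ 2 ^ 2" where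
  "sl2_e = (\<chi> i j. if i = 1 \<and> j = 2 then 1 else 0)"

definition sl2_f :: "'a::field ^ 2 ^ 2" where
  "sl2_f = (\<chi> i j. if i = 2 \<and> j = 1 then 1 else 0)"

definition sl2_dual :: "('a::field ^ 2 ^ 2 \<Rightarrow> 'a) set" where
  "sl2_dual = {\<psi>. (\<forall>x\<in>sl2. \<forall>y\<in>sl2. \<psi> (x + y) = \<psi> x + \<psi> y) \<and>
                   (\<forall>c. \<forall>x\<in>sl2. \<psi> (mscale c x) = c * \<psi> x)}"

text \<open>
  A module is given by its carrier \<open>M\<close>, a subspace of the vector space \<open>'a poly\<close>, and by
  the action \<open>act\<close> of sl(2) on it. Only the values of \<open>act\<close>, of a derivation and of a 2-local
  derivation on \<open>sl2\<close> matter.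
\<close>

definition Der :: "'a::field poly set \<Rightarrow> ('a ^ 2 ^ 2 \<Rightarrow> 'a poly \<Rightarrow> 'a poly)
    \<Rightarrow> ('a ^ 2 ^ 2 \<Rightarrow> 'a poly) set" where
  "Der M act = {D.
     (\<forall>x\<in>sl2. D x \<in> M) \<and>
     (\<forall>x\<in>sl2. \<forall>y\<in>sl2. D (x + y) = D x + D y) \<and>
     (\<forall>c. \<forall>x\<in>sl2. D (mscale c x) = smult c (D x)) \<and>
     (\<forall>x\<in>sl2. \<forall>y\<in>sl2. D (bracket x y) = act x (D y) - act y (D x))}"

definition two_local_derivation :: "'a::field poly set \<Rightarrow> ('a ^ 2 ^ 2 \<Rightarrow> 'a poly \<Rightarrow> 'a poly)
    \<Rightarrow> ('a ^ 2 ^ 2 \<Rightarrow> 'a poly) \<Rightarrow> bool" where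
  "two_local_derivation M act \<phi> \<longleftrightarrow>
     (\<forall>x\<in>sl2. \<phi> x \<in> M) \<and>
     (\<forall>x\<in>sl2. \<forall>y\<in>sl2. \<exists>D\<in>Der M act. \<phi> x = D x \<and> \<phi> y = D y)"

definition Lambda :: "('a::field ^ 2 ^ 2 \<Rightarrow> 'a) \<Rightarrow> 'a set" where
  "Lambda chi = {l. l ^ CHAR('a) - l = chi sl2_h ^ CHAR('a)}"

text \<open>The representative in \<open>{0..<p}\<close> of an element of the prime field.\<close>

definition Phi :: "'a::field \<Rightarrow> nat" where
  "Phi l = (THE n. n < CHAR('a) \<and> of_nat n = l)"

text \<open>When \<open>chi sl2_e = 0\<close>, the \<open>else\<close> case is that of \<open>chi = 0\<close> on \<open>sl2\<close>.\<close>

definition L_dim :: "('a::field ^ 2 ^ 2 \<Rightarrow> 'a) \<Rightarrow> 'a \<Rightarrow> nat" where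
  "L_dim chi l = (if chi sl2_h \<noteq> 0 \<or> chi sl2_f \<noteq> 0 then CHAR('a) else Phi l + 1)"

text \<open>
  The basis vector \<open>v\<^sub>i\<close> is the monomial of degree \<open>i\<close>, so that the module is the space of the
  polynomials of degree less than \<open>L_dim chi l\<close>.
\<close>

definition L_carrier :: "('a::field ^ 2 ^ 2 \<Rightarrow> 'a) \<Rightarrow> 'a \<Rightarrow> 'a poly set" where
  "L_carrier chi l = {q. \<forall>i\<ge>L_dim chi l. coeff q i = 0}"

definition L_basis :: "nat \<Rightarrow> 'a::field poly" where
  "L_basis i = monom 1 i"

definition L_e :: "('a::field ^ 2 ^ 2 \<Rightarrow> 'a) \<Rightarrow> 'a \<Rightarrow> nat \<Rightarrow> 'a poly" where
  "L_e chi l i = smult (of_nat i * (l - of_nat i + 1)) (L_basis (i - 1))"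

definition L_h :: "('a::field ^ 2 ^ 2 \<Rightarrow> 'a) \<Rightarrow> 'a \<Rightarrow> nat \<Rightarrow> 'a poly" where
  "L_h chi l i = smult (l - 2 * of_nat i) (L_basis i)"

text \<open>For \<open>chi = 0\<close> the second case gives \<open>0\<close>, as \<open>CHAR('a) > 0\<close>.\<close>

definition L_f :: "('a::field ^ 2 ^ 2 \<Rightarrow> 'a) \<Rightarrow> 'a \<Rightarrow> nat \<Rightarrow> 'a poly" where
  "L_f chi l i = (if i + 1 < L_dim chi l then L_basis (i + 1)
                  else smult (chi sl2_f ^ CHAR('a)) (L_basis 0))"

text \<open>
  The bilinear extension of \<open>L_e\<close>, \<open>L_h\<close>, \<open>L_f\<close>. The coordinates of \<open>x\<close> in \<open>sl2\<close> with respect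
  to \<open>sl2_e\<close>, \<open>sl2_f\<close>, \<open>sl2_h\<close> are \<open>x $ 1 $ 2\<close>, \<open>x $ 2 $ 1\<close>, \<open>x $ 1 $ 1\<close>.
\<close>

definition L_act :: "('a::field ^ 2 ^ 2 \<Rightarrow> 'a) \<Rightarrow> 'a \<Rightarrow> 'a ^ 2 ^ 2 \<Rightarrow> 'a poly \<Rightarrow> 'a poly" where
  "L_act chi l x q = (\<Sum>i<L_dim chi l. smult (coeff q i)
     (smult (x $ 1 $ 2) (L_e chi l i) + smult (x $ 2 $ 1) (L_f chi l i)
        + smult (x $ 1 $ 1) (L_h chi l i)))"

text \<open>
  The remaining facts justify the explicit model: \<open>L_carrier chi l\<close> with \<open>L_act chi l\<close> is a simple
  sl(2)-module that contains a vector \<open>v\<^sub>0 \<noteq> 0\<close> with \<open>e v\<^sub>0 = 0\<close> and \<open>h v\<^sub>0 = l v\<^sub>0\<close>, and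
  \<open>x\<^sup>p - x\<^sup>[\<^sup>p\<^sup>]\<close> acts on it as \<open>chi(x)\<^sup>p\<close> for \<open>x = e, f, h\<close> (if \<open>chi(e) = 0\<close>), hence for all \<open>x\<close>, both
  sides being p-semilinear in \<open>x\<close>. So it is the simple quotient of the baby Verma module
  with parameters \<open>chi\<close> and \<open>l\<close>.
\<close>

lemma power_CHAR_add:
  fixes a b :: "'a::field"
  assumes "CHAR('a) > 0"
  shows "(a + b) ^ CHAR('a) = a ^ CHAR('a) + b ^ CHAR('a)"
proof -
  let ?p = "CHAR('a)"
  have pr: "prime ?p" using assms by (rule prime_CHAR_semidom)
  have "(a + b) ^ ?p = (\<Sum>k\<le>?p. of_nat (?p choose k) * a ^ k * b ^ (?p - k))"
    by (rule binomial_ring)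
  also have "\<dots> = (\<Sum>k\<in>{0, ?p}. of_nat (?p choose k) * a ^ k * b ^ (?p - k))"
  proof (rule sum.mono_neutral_right)
    show "\<forall>i\<in>{..?p} - {0, ?p}. of_nat (?p choose i) * a ^ i * b ^ (?p - i) = 0"
    proof
      fix i assume i: "i \<in> {..?p} - {0, ?p}"
      have "?p dvd (?p choose i)" by (rule dvd_choose_prime) (use i pr assms in auto)
      then have "of_nat (?p choose i) = (0 :: 'a)" by (simp add: of_nat_eq_0_iff_char_dvd)
      then show "of_nat (?p choose i) * a ^ i * b ^ (?p - i) = 0" by simp
    qed
  qed auto
  also have "\<dots> = a ^ ?p + b ^ ?p" using assms by simp
  finally show ?thesis .
qed

lemma power_CHAR_of_nat:
  assumes "CHAR('a::field) > 0"
  shows "(of_nat n :: 'a) ^ CHAR('a) = of_nat n"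
  by (induction n) (use assms in \<open>simp_all add: power_CHAR_add\<close>)

lemma of_nat_inj_CHAR:
  assumes "of_nat i = (of_nat j :: 'a::field)" "i < CHAR('a)" "j < CHAR('a)"
  shows "i = j"
proof -
  have *: "a = b" if "a \<le> b" "of_nat a = (of_nat b :: 'a)" "b < CHAR('a)" for a b
  proof (rule ccontr)
    assume "a \<noteq> b"
    have "of_nat (b - a) = (0 :: 'a)" using that by (simp add: of_nat_diff)
    then have "CHAR('a) dvd b - a" by (simp add: of_nat_eq_0_iff_char_dvd)
    then show False using that \<open>a \<noteq> b\<close> by (auto dest: dvd_imp_le)
  qed
  from assms show ?thesis using *[of i j] *[of j i] by (cases "i \<le> j") auto
qed

lemma prime_field_iff:
  fixes l :: "'a::field"
  assumes p: "CHAR('a) > 1"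
  shows "l ^ CHAR('a) = l \<longleftrightarrow> (\<exists>n<CHAR('a). of_nat n = l)"
proof -
  let ?p = "CHAR('a)" and ?A = "of_nat ` {..<CHAR('a)} :: 'a set"
  define P :: "'a poly" where "P = monom 1 ?p - monom 1 1"
  have c: "coeff P ?p = 1" using p by (simp add: P_def)
  have P0: "P \<noteq> 0" using c by auto
  have deg: "degree P \<le> ?p" unfolding P_def
    by (rule degree_diff_le) (use p in \<open>auto simp: degree_monom_eq\<close>)
  have R: "{x. poly P x = 0} = {x. x ^ ?p = x}" by (auto simp: P_def poly_monom)
  have fin: "finite {x::'a. x ^ ?p = x}" using poly_roots_finite[OF P0] by (simp add: R)
  have le: "card {x::'a. x ^ ?p = x} \<le> ?p"
    using card_poly_roots_bound[OF P0] deg by (simp add: R)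
  have cA: "card ?A = ?p"
    by (subst card_image) (auto intro!: inj_onI dest: of_nat_inj_CHAR)
  have sub: "?A \<subseteq> {x. x ^ ?p = x}"
  proof (rule image_subsetI)
    fix n
    have "(of_nat n :: 'a) ^ ?p = of_nat n" by (rule power_CHAR_of_nat) (use p in linarith)
    then show "of_nat n \<in> {x::'a. x ^ ?p = x}" by (rule CollectI)
  qed
  have "?A = {x. x ^ ?p = x}"
    by (rule card_seteq[OF fin sub]) (simp only: cA le)
  then have "l \<in> ?A \<longleftrightarrow> l \<in> {x. x ^ ?p = x}" by (simp only:)
  then show ?thesis unfolding image_iff Bex_def lessThan_iff mem_Collect_eq by metis
qed

lemma Phi:
  fixes l :: "'a::field"
  assumes "CHAR('a) > 1" "l ^ CHAR('a) = l"
  shows "Phi l < CHAR('a)" "of_nat (Phi l) = l"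
proof -
  obtain n where n: "n < CHAR('a)" "of_nat n = l" using prime_field_iff[of l] assms by blast
  have "Phi l = n" unfolding Phi_def
  proof (rule the_equality)
    fix i assume "i < CHAR('a) \<and> of_nat i = l"
    then show "i = n" using of_nat_inj_CHAR[where 'a = 'a, of i n] n by simp
  qed (use n in simp)
  with n show "Phi l < CHAR('a)" "of_nat (Phi l) = l" by simp_all
qed

lemma L_dim:
  fixes l :: "'a::field"
  assumes p: "CHAR('a) > 1" and l: "l \<in> Lambda chi"
  shows "0 < L_dim chi l" "L_dim chi l \<le> CHAR('a)"
    "of_nat (L_dim chi l) * (l - of_nat (L_dim chi l) + 1) = 0"
    "of_nat (L_dim chi l) * chi sl2_f ^ CHAR('a) = 0"
proof -
  have "l ^ CHAR('a) = l" if "chi sl2_h = 0"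
    using l p that by (simp add: Lambda_def power_0_left)
  note Phi = Phi[OF p this]
  show "0 < L_dim chi l" "L_dim chi l \<le> CHAR('a)"
    using p Phi by (auto simp: L_dim_def Suc_le_eq)
  show "of_nat (L_dim chi l) * (l - of_nat (L_dim chi l) + 1) = 0"
    "of_nat (L_dim chi l) * chi sl2_f ^ CHAR('a) = 0"
    using p Phi by (auto simp: L_dim_def power_0_left)
qed

lemma coeff_L_act:
  assumes d: "0 < L_dim chi l"
  shows "coeff (L_act chi l x q) j = (if j < L_dim chi l then
     x $ 1 $ 2 * (if j + 1 < L_dim chi l
                  then of_nat (j + 1) * (l - of_nat j) * coeff q (j + 1) else 0)
     + x $ 2 $ 1 * (if j = 0 then chi sl2_f ^ CHAR('a) * coeff q (L_dim chi l - 1)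
                    else coeff q (j - 1))
     + x $ 1 $ 1 * ((l - 2 * of_nat j) * coeff q j) else (0::'a::field))"
proof -
  let ?d = "L_dim chi l"
  have "coeff (L_act chi l x q) j =
     (\<Sum>i<?d. x $ 1 $ 2 * (coeff q i * coeff (L_e chi l i) j)
      + x $ 2 $ 1 * (coeff q i * coeff (L_f chi l i) j)
      + x $ 1 $ 1 * (coeff q i * coeff (L_h chi l i) j))"
    unfolding L_act_def coeff_sum
    by (rule sum.cong[OF refl]) (simp only: coeff_smult coeff_add distrib_left mult.left_commute)
  also have "\<dots> = x $ 1 $ 2 * (\<Sum>i<?d. coeff q i * coeff (L_e chi l i) j)
     + x $ 2 $ 1 * (\<Sum>i<?d. coeff q i * coeff (L_f chi l i) j)
     + x $ 1 $ 1 * (\<Sum>i<?d. coeff q i * coeff (L_h chi l i) j)"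
    by (simp add: sum.distrib sum_distrib_left)
  also have "(\<Sum>i<?d. coeff q i * coeff (L_e chi l i) j) =
     (\<Sum>i<?d. if i = Suc j then of_nat (j + 1) * (l - of_nat j) * coeff q (j + 1) else 0)"
  proof (rule sum.cong)
    fix i
    show "coeff q i * coeff (L_e chi l i) j =
      (if i = Suc j then of_nat (j + 1) * (l - of_nat j) * coeff q (j + 1) else 0)"
      by (cases i) (simp_all add: L_e_def L_basis_def)
  qed simp
  also have "(\<Sum>i<?d. coeff q i * coeff (L_h chi l i) j) =
     (\<Sum>i<?d. if i = j then (l - 2 * of_nat j) * coeff q j else 0)"
    by (rule sum.cong) (simp_all add: L_h_def L_basis_def)
  also have "(\<Sum>i<?d. coeff q i * coeff (L_f chi l i) j) =
     (\<Sum>i<?d. if i = (if j = 0 then ?d - 1 else j - 1) then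
        (if j = 0 then chi sl2_f ^ CHAR('a) * coeff q i else if j < ?d then coeff q i else 0) else 0)"
  proof (rule sum.cong)
    fix i assume i: "i \<in> {..<?d}"
    show "coeff q i * coeff (L_f chi l i) j =
      (if i = (if j = 0 then ?d - 1 else j - 1) then
        (if j = 0 then chi sl2_f ^ CHAR('a) * coeff q i else if j < ?d then coeff q i else 0) else 0)"
    proof (cases "i + 1 < ?d")
      case True
      then show ?thesis by (cases j) (auto simp: L_f_def L_basis_def)
    next
      case False
      with i have "?d = Suc i" by simp
      then show ?thesis by (cases j) (auto simp: L_f_def L_basis_def)
    qed
  qed simp
  finally show ?thesis using d by (cases j) (simp_all add: sum.delta)
qed

lemma sl2_D: "x \<in> sl2 \<Longrightarrow> x $ 2 $ 2 = - x $ 1 $ 1"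
  by (simp add: sl2_def trace_def sum_2 eq_neg_iff_add_eq_0 add.commute)

lemma sl2_basis: "sl2_h \<in> sl2" "sl2_e \<in> sl2" "sl2_f \<in> sl2"
  by (auto simp: sl2_def sl2_h_def sl2_e_def sl2_f_def trace_def sum_2)

lemma sl2_basis_nth [simp]:
  "sl2_h $ 1 $ 1 = 1" "sl2_h $ 1 $ 2 = 0" "sl2_h $ 2 $ 1 = 0"
  "sl2_e $ 1 $ 1 = 0" "sl2_e $ 1 $ 2 = 1" "sl2_e $ 2 $ 1 = 0"
  "sl2_f $ 1 $ 1 = 0" "sl2_f $ 1 $ 2 = 0" "sl2_f $ 2 $ 1 = 1"
  by (auto simp: sl2_h_def sl2_e_def sl2_f_def)

lemma L_act_linear:
  "L_act chi l (x + y) q = L_act chi l x q + L_act chi l y q"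
  "L_act chi l (mscale c x) q = smult c (L_act chi l x q)"
  "L_act chi l x (q + r) = L_act chi l x q + L_act chi l x r"
  "L_act chi l x (smult c q) = smult c (L_act chi l x q)"
  by (rule poly_eqI, simp add: L_act_def mscale_def coeff_sum sum_distrib_left
      sum.distrib[symmetric] algebra_simps)+

lemma L_act_closed:
  assumes "CHAR('a::field) > 1" "l \<in> Lambda chi"
  shows "L_act chi l x q \<in> L_carrier chi (l::'a)"
  using L_dim(1)[OF assms] by (simp add: L_carrier_def coeff_L_act)

theorem L_act_bracket:
  fixes l :: "'a::field"
  assumes "CHAR('a) > 1" "l \<in> Lambda chi"
    and x: "x \<in> sl2" and y: "y \<in> sl2" 
  shows "L_act chi l (bracket x y) q =
         L_act chi l x (L_act chi l y q) - L_act chi l y (L_act chi l x q)"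
proof -
  define d where "d = L_dim chi l"
  define c where "c = chi sl2_f ^ CHAR('a)"
  have d0: "0 < d" and d1: "of_nat d * (l - of_nat d + 1) = 0" and d2: "of_nat d * c = 0"
    using L_dim[OF assms(1,2)] by (auto simp: d_def c_def)
  obtain k where k: "d = Suc k" using d0 by (cases d) auto
  have e1: "(of_nat k + 1) * (l - of_nat k) = 0" using d1 by (simp add: k algebra_simps)
  have e2: "(of_nat k + 1) * c = 0" using d2 by (simp add: k algebra_simps)
  have C: "coeff (L_act chi l z r) j = (if j < Suc k then
     z $ 1 $ 2 * (if j < k then (of_nat j + 1) * (l - of_nat j) * coeff r (Suc j) else 0)
     + z $ 2 $ 1 * (if j = 0 then c * coeff r k else coeff r (j - 1))
     + z $ 1 $ 1 * ((l - 2 * of_nat j) * coeff r j) else 0)" for z r j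
    using coeff_L_act[of chi l z r j] d0 k unfolding d_def[symmetric] c_def[symmetric]
    by (simp add: add.commute)
  have B: "bracket x y $ 1 $ 1 = x $ 1 $ 2 * y $ 2 $ 1 - y $ 1 $ 2 * x $ 2 $ 1"
    "bracket x y $ 1 $ 2 = 2 * (x $ 1 $ 1 * y $ 1 $ 2 - y $ 1 $ 1 * x $ 1 $ 2)"
    "bracket x y $ 2 $ 1 = 2 * (y $ 1 $ 1 * x $ 2 $ 1 - x $ 1 $ 1 * y $ 2 $ 1)"
    using sl2_D[OF x] sl2_D[OF y]
    by (simp_all add: bracket_def matrix_matrix_mult_def sum_2 algebra_simps)
  show ?thesis
  proof (rule poly_eqI)
    fix j
    consider "j > k" | "j = 0" "k = 0" | "j = 0" "k > 0" | "0 < j" "j < k" | "0 < j" "j = k"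
      by linarith
    then show "coeff (L_act chi l (bracket x y) q) j =
      coeff (L_act chi l x (L_act chi l y q) - L_act chi l y (L_act chi l x q)) j"
    proof cases
      case 1
      then show ?thesis by (simp add: C)
    next
      case 2
      then have l0: "l = 0" and c0: "c = 0" using e1 e2 by auto
      show ?thesis by (simp add: C B 2) (simp add: l0 c0)
    next
      case 3
      have "k = Suc (k - 1)" using 3 by simp
      then obtain i where i: "k = Suc i" by blast
      have e2': "(of_nat i + 1 + 1) * c = 0" using e2 by (simp add: i algebra_simps)
      have "coeff (L_act chi l (bracket x y) q) 0 =
        coeff (L_act chi l x (L_act chi l y q) - L_act chi l y (L_act chi l x q)) 0"
      proof (cases i)
        case 0
        have e: "(1 + 1) * c = 0" using e2' 0 by simp
        show ?thesis by (simp add: C B i 0) (use e in algebra)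
      next
        case (Suc n)
        have e: "(of_nat n + 1 + 1 + 1) * c = 0" using e2' by (simp add: Suc algebra_simps)
        show ?thesis by (simp add: C B i Suc) (use e in algebra)
      qed
      then show ?thesis using 3(1) by simp
    next
      case 4
      then obtain i where i: "j = Suc i" by (cases j) auto
      show ?thesis using 4(2) by (cases i) (simp_all add: C B i algebra_simps)
    next
      case 5
      then obtain i where i: "k = Suc i" by (cases k) auto
      have e1': "(of_nat i + 1 + 1) * (l - of_nat i - 1) = 0" using e1 by (simp add: i algebra_simps)
      have "coeff (L_act chi l (bracket x y) q) (Suc i) =
        coeff (L_act chi l x (L_act chi l y q) - L_act chi l y (L_act chi l x q)) (Suc i)"
      proof (cases i)
        case 0
        have e: "(1 + 1) * (l - 1) = 0" using e1' 0 by simp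
        show ?thesis by (simp add: C B i 0) (use e in algebra)
      next
        case (Suc n)
        have e: "(of_nat n + 1 + 1 + 1) * (l - of_nat n - 1 - 1) = 0"
          using e1' by (simp add: Suc algebra_simps)
        show ?thesis by (simp add: C B i Suc) (use e in algebra)
      qed
      then show ?thesis using 5 i by simp
    qed
  qed
qed

lemma L_basis_in_carrier: "i < L_dim chi l \<Longrightarrow> L_basis i \<in> L_carrier chi l"
  by (auto simp: L_carrier_def L_basis_def)

lemma L_act_basis:
  assumes "i < L_dim chi l"
  shows "L_act chi l x (L_basis i) = smult (x $ 1 $ 2) (L_e chi l i)
    + smult (x $ 2 $ 1) (L_f chi l i) + smult (x $ 1 $ 1) (L_h chi l i)"
proof -
  let ?g = "\<lambda>i. smult (x $ 1 $ 2) (L_e chi l i)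
    + smult (x $ 2 $ 1) (L_f chi l i) + smult (x $ 1 $ 1) (L_h chi l i)"
  have "L_act chi l x (L_basis i) = (\<Sum>j<L_dim chi l. if j = i then ?g i else 0)"
    unfolding L_act_def by (rule sum.cong) (auto simp: L_basis_def)
  then show ?thesis using assms by simp
qed

theorem L_act_power_CHAR:
  fixes l :: "'a::field"
  assumes p: "CHAR('a) > 1" and l: "l \<in> Lambda chi" and q: "q \<in> L_carrier chi l"
  shows "(L_act chi l sl2_e ^^ CHAR('a)) q = 0"
    and "(L_act chi l sl2_f ^^ CHAR('a)) q = smult (chi sl2_f ^ CHAR('a)) q"
    and "(L_act chi l sl2_h ^^ CHAR('a)) q - L_act chi l sl2_h q = smult (chi sl2_h ^ CHAR('a)) q"
proof -
  let ?p = "CHAR('a)" and ?d = "L_dim chi l"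
  note d = L_dim[OF p l]
  note C = coeff_L_act[OF d(1)]
  have q0: "coeff q j = 0" if "j \<ge> ?d" for j using q that by (simp add: L_carrier_def)
  have "coeff ((L_act chi l sl2_e ^^ n) q) j = 0" if "?d \<le> j + n" for n j
    using that by (induction n arbitrary: j) (simp_all add: C q0)
  then show "(L_act chi l sl2_e ^^ ?p) q = 0"
    using d(2) by (intro poly_eqI) simp
  show "(L_act chi l sl2_f ^^ ?p) q = smult (chi sl2_f ^ ?p) q"
  proof (cases "?d = ?p")
    case True
    have F: "coeff ((L_act chi l sl2_f ^^ n) q) j = (if j < ?p then
       (if j < n then chi sl2_f ^ ?p * coeff q (j + ?p - n) else coeff q (j - n)) else 0)"
      if "n \<le> ?p" for n j
      using that
    proof (induction n arbitrary: j)
      case 0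
      then show ?case using q0 True by simp
    next
      case (Suc n)
      then show ?case using p by (cases j) (simp_all add: C True Suc_diff_Suc)
    qed
    show ?thesis by (intro poly_eqI) (use q0 True in \<open>simp add: F\<close>)
  next
    case False
    then have c0: "chi sl2_f = 0" by (auto simp: L_dim_def split: if_splits)
    have "coeff ((L_act chi l sl2_f ^^ n) q) j = 0" if "j < n \<or> ?d \<le> j" for n j
      using that
    proof (induction n arbitrary: j)
      case 0
      then show ?case using q0 by simp
    next
      case (Suc n)
      then show ?case using p by (cases j) (auto simp: C c0 power_0_left)
    qed
    then have "coeff ((L_act chi l sl2_f ^^ ?p) q) j = 0" for j
      using d(2) by (cases "j < ?p") auto
    then show ?thesis using p by (intro poly_eqI) (simp add: c0 power_0_left)
  qed
  have H: "coeff ((L_act chi l sl2_h ^^ n) q) j = (l - 2 * of_nat j) ^ n * coeff q j" for n j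
    by (induction n) (simp_all add: C q0)
  have a: "(l - 2 * of_nat j) ^ ?p - (l - 2 * of_nat j) = chi sl2_h ^ ?p" for j
  proof -
    define a where "a = l - of_nat (2 * j)"
    have "l ^ ?p = (a + of_nat (2 * j)) ^ ?p" by (simp add: a_def)
    also have "\<dots> = a ^ ?p + of_nat (2 * j) ^ ?p" using p by (intro power_CHAR_add) simp
    also have "of_nat (2 * j) ^ ?p = (of_nat (2 * j) :: 'a)" using p by (intro power_CHAR_of_nat) simp
    finally have "a ^ ?p - a = l ^ ?p - l" by (simp add: a_def)
    moreover have "l ^ ?p - l = chi sl2_h ^ ?p" using l by (simp only: Lambda_def mem_Collect_eq)
    moreover have "l - 2 * of_nat j = a" by (simp add: a_def)
    ultimately show ?thesis by (simp only:)
  qed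
  show "(L_act chi l sl2_h ^^ ?p) q - L_act chi l sl2_h q = smult (chi sl2_h ^ ?p) q"
  proof (rule poly_eqI)
    fix j
    show "coeff ((L_act chi l sl2_h ^^ ?p) q - L_act chi l sl2_h q) j =
        coeff (smult (chi sl2_h ^ ?p) q) j"
      using H[of 1 j] by (simp add: H left_diff_distrib a[of j, symmetric])
  qed
qed

theorem L_highest_weight:
  assumes "CHAR('a::field) > 1" "l \<in> Lambda chi"
  shows "L_act chi l sl2_e (L_basis 0) = 0"
    and "L_act chi l sl2_h (L_basis 0) = smult (l::'a) (L_basis 0)"
  using L_dim(1)[OF assms] by (simp_all add: L_act_basis L_e_def L_h_def)

theorem L_irreducible:
  fixes l :: "'a::field"
  assumes p: "CHAR('a) > 2" and l: "l \<in> Lambda chi"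
    and W: "W \<subseteq> L_carrier chi l"
    and W_add: "\<And>q r. q \<in> W \<Longrightarrow> r \<in> W \<Longrightarrow> q + r \<in> W"
    and W_smult: "\<And>c q. q \<in> W \<Longrightarrow> smult c q \<in> W"
    and W_act: "\<And>x q. x \<in> sl2 \<Longrightarrow> q \<in> W \<Longrightarrow> L_act chi l x q \<in> W"
    and W_nonzero: "q0 \<in> W" "q0 \<noteq> 0"
  shows "W = L_carrier chi l"
proof -
  let ?p = "CHAR('a)" and ?d = "L_dim chi l"
  have p1: "?p > 1" using p by simp
  have prime: "prime ?p" using p by (intro prime_CHAR_semidom) simp
  note d = L_dim[OF p1 l]
  note C = coeff_L_act[OF d(1)]
  have W0: "coeff q j = 0" if "q \<in> W" "j \<ge> ?d" for q j
    using W that by (auto simp: L_carrier_def)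
  have W_cancel: "q \<in> W" if "smult c q \<in> W" "c \<noteq> 0" for c q
    using W_smult[OF that(1), of "inverse c"] that(2) by simp
  have two: "(2 :: 'a) \<noteq> 0"
    using p of_nat_eq_0_iff_char_dvd[where 'a = 'a, of 2] by (auto dest: dvd_imp_le)
  have "\<exists>k<?d. L_basis k \<in> W"
  proof -
    define q where "q = arg_min (\<lambda>q. card {i. coeff q i \<noteq> 0}) (\<lambda>q. q \<in> W \<and> q \<noteq> 0)"
    have q: "q \<in> W" "q \<noteq> 0"
      and q_min: "r \<in> W \<Longrightarrow> r \<noteq> 0 \<Longrightarrow> card {i. coeff q i \<noteq> 0} \<le> card {i. coeff r i \<noteq> 0}" for r
      using arg_min_nat_lemma[of "\<lambda>q. q \<in> W \<and> q \<noteq> 0" q0 "\<lambda>q. card {i. coeff q i \<noteq> 0}"] W_nonzero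
      unfolding q_def by simp_all
    obtain a where a: "coeff q a \<noteq> 0" using q(2) by (metis leading_coeff_0_iff)
    then have ad: "a < ?d" using W0[OF q(1)] by (meson leI)
    have "coeff q b = 0" if b: "b \<noteq> a" for b
    proof (rule ccontr)
      assume nz: "coeff q b \<noteq> 0"
      then have bd: "b < ?d" using W0[OF q(1)] by (meson leI)
      define r where "r = L_act chi l sl2_h q + smult (- (l - 2 * of_nat a)) q"
      have rc: "coeff r j = 2 * (of_nat a - of_nat j) * coeff q j" for j
        using W0[OF q(1), of j] by (simp add: r_def C algebra_simps)
      have "of_nat a \<noteq> (of_nat b :: 'a)"
        using of_nat_inj_CHAR[where 'a = 'a, of a b] b ad bd d(2) by auto
      then have "coeff r b \<noteq> 0" using nz two by (simp add: rc)
      then have "r \<noteq> 0" by auto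
      moreover have "r \<in> W" unfolding r_def by (intro W_add W_smult W_act q sl2_basis)
      ultimately have "card {i. coeff q i \<noteq> 0} \<le> card {i. coeff r i \<noteq> 0}" by (rule q_min[rotated])
      moreover have "{i. coeff r i \<noteq> 0} \<subset> {i. coeff q i \<noteq> 0}" using a by (auto simp: rc)
      moreover have "finite {i. coeff q i \<noteq> 0}"
        by (rule finite_subset[of _ "{..<?d}"]) (use W0[OF q(1)] in \<open>force simp: not_le[symmetric]\<close>, simp)
      ultimately show False by (meson psubset_card_mono not_less)
    qed
    then have "q = smult (coeff q a) (L_basis a)"
      by (intro poly_eqI) (auto simp: L_basis_def)
    then have "L_basis a \<in> W" using W_cancel[of "coeff q a" "L_basis a"] a q(1) by simp
    with ad show ?thesis by blast
  qed
  then obtain k where k: "k < ?d" "L_basis k \<in> W" by blast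
  have up: "L_basis (i + n) \<in> W" if "L_basis i \<in> W" "i + n < ?d" for i n
    using that
  proof (induction n)
    case (Suc n)
    then have "L_act chi l sl2_f (L_basis (i + n)) \<in> W" by (intro W_act sl2_basis) simp
    then show ?case using Suc.prems by (simp add: L_act_basis L_f_def)
  qed simp
  have v0: "L_basis 0 \<in> W"
  proof (cases "chi sl2_f = 0")
    case False
    have "L_basis (?d - 1) \<in> W" using up[of k "?d - 1 - k"] k by simp
    then have "L_act chi l sl2_f (L_basis (?d - 1)) \<in> W" by (intro W_act sl2_basis)
    then have "smult (chi sl2_f ^ ?p) (L_basis 0) \<in> W" using d(1) by (simp add: L_act_basis L_f_def)
    then show ?thesis by (rule W_cancel) (use False in simp)
  next
    case f0: True
    have nz: "of_nat i * (l - of_nat i + 1) \<noteq> 0" if i: "0 < i" "i < ?d" for i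
    proof -
      have "of_nat i \<noteq> (0 :: 'a)"
        using of_nat_inj_CHAR[where 'a = 'a, of i 0] i d(2) by auto
      moreover have "l - of_nat i + 1 \<noteq> 0"
      proof
        assume "l - of_nat i + 1 = 0"
        then have li: "l = of_nat (i - 1)" using i by (simp add: of_nat_diff algebra_simps)
        have "l ^ ?p = l" unfolding li using p by (intro power_CHAR_of_nat) simp
        then have "chi sl2_h = 0" using l p by (simp add: Lambda_def)
        then have "?d = Phi l + 1" using f0 by (simp add: L_dim_def)
        moreover have "Phi l = i - 1"
          using Phi[OF p1 \<open>l ^ ?p = l\<close>] li i d(2)
            of_nat_inj_CHAR[where 'a = 'a, of "Phi l" "i - 1"] by simp
        ultimately show False using i by simp
      qed
      ultimately show ?thesis by simp
    qed
    have "L_basis i \<in> W \<Longrightarrow> i < ?d \<Longrightarrow> L_basis 0 \<in> W" for i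
    proof (induction i)
      case (Suc i)
      then have "L_act chi l sl2_e (L_basis (Suc i)) \<in> W" by (intro W_act sl2_basis)
      then have "smult (of_nat (Suc i) * (l - of_nat (Suc i) + 1)) (L_basis i) \<in> W"
        using Suc.prems(2) by (simp add: L_act_basis L_e_def del: of_nat_Suc)
      then have "L_basis i \<in> W" by (rule W_cancel) (use nz[of "Suc i"] Suc.prems(2) in simp)
      then show ?case using Suc by simp
    qed
    then show ?thesis using k by blast
  qed
  have "q \<in> W" if q: "q \<in> L_carrier chi l" for q
  proof -
    have "(\<Sum>i<n. smult (coeff q i) (L_basis i)) \<in> W" if "n \<le> ?d" for n
      using that
    proof (induction n)
      case 0
      then show ?case using W_smult[OF v0, of 0] by simp
    next
      case (Suc n)
      then show ?case using up[OF v0, of n] by (auto intro: W_add W_smult)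
    qed
    moreover have "q = (\<Sum>i<?d. smult (coeff q i) (L_basis i))"
    proof (rule poly_eqI)
      fix j
      have "coeff (\<Sum>i<?d. smult (coeff q i) (L_basis i)) j = (\<Sum>i<?d. if i = j then coeff q j else 0)"
        unfolding coeff_sum by (rule sum.cong) (auto simp: L_basis_def)
      then show "coeff q j = coeff (\<Sum>i<?d. smult (coeff q i) (L_basis i)) j"
        using q by (simp add: L_carrier_def)
    qed
    ultimately show ?thesis by (metis order_refl)
  qed
  with W show ?thesis by blast
qed

end

theory Submission
  imports Defs
begin

text \<open>
  A derivation is determined by its values on \<open>h\<close>, \<open>e\<close>, \<open>f\<close>, and the bracket relations then
  severely restrict the derivations that vanish at a well-chosen element. If \<open>f\<close> acts injectively
  (\<open>chi(f) \<noteq> 0\<close>), a derivation vanishing at \<open>f\<close> is zero; if \<open>h - 2\<close> and \<open>h + 2\<close> do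
  (\<open>chi(h) \<noteq> 0\<close>, or \<open>chi = 0\<close> and \<open>l = 1\<close> with \<open>p \<noteq> 3\<close>), a derivation vanishing at \<open>h\<close> is zero.
  In both cases a 2-local derivation coincides with any derivation that agrees with it at that
  element. In the remaining cases \<open>chi = 0\<close>; let \<open>N = Phi l\<close>. If \<open>N = 0\<close> there is no nonzero
  derivation. If \<open>N > 0\<close>, the values of a derivation vanishing at \<open>e\<close> lie in the span of
  \<open>v\<^sub>0, v\<^sub>1\<close>, those of a derivation vanishing at \<open>f\<close> in the span of \<open>v\<^bsub>N-1\<^esub>, v\<^sub>N\<close>. For \<open>N \<ge> 3\<close> these
  spans meet trivially, so a 2-local derivation coincides with a derivation that agrees with it
  at \<open>e\<close> and \<open>f\<close>. For \<open>N = 1, 2\<close> the difference of the two also vanishes at \<open>h\<close>, and the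
  weights of \<open>h\<close> do the rest.
\<close>

section \<open>Derivations of sl(2)\<close>

lemma sl2_eqI:
  assumes "x \<in> sl2" "y \<in> sl2" "x $ 1 $ 1 = y $ 1 $ 1" "x $ 1 $ 2 = y $ 1 $ 2" "x $ 2 $ 1 = y $ 2 $ 1"
  shows "x = y"
  using assms by (simp add: vec_eq_iff forall_2 sl2_D)

lemma sl2_closed:
  "x \<in> sl2 \<Longrightarrow> y \<in> sl2 \<Longrightarrow> x + y \<in> sl2"
  "x \<in> sl2 \<Longrightarrow> mscale c x \<in> sl2"
  "bracket x y \<in> sl2"
  by (auto simp: sl2_def trace_def sum_2 mscale_def bracket_def matrix_matrix_mult_def algebra_simps
      simp flip: distrib_left)

lemma sl2_nth [simp]:
  "mscale c x $ i $ j = c * x $ i $ j"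
  "sl2_h $ 2 $ 2 = -1" "sl2_e $ 2 $ 2 = 0" "sl2_f $ 2 $ 2 = 0"
  by (simp_all add: mscale_def sl2_h_def sl2_e_def sl2_f_def)

lemma sl2_decompose:
  assumes "x \<in> sl2"
  shows "x = mscale (x $ 1 $ 2) sl2_e + mscale (x $ 2 $ 1) sl2_f + mscale (x $ 1 $ 1) sl2_h"
  by (rule sl2_eqI) (use assms in \<open>auto intro!: sl2_closed sl2_basis\<close>)

lemma bracket_basis:
  "bracket sl2_h sl2_e = mscale 2 sl2_e"
  "bracket sl2_h sl2_f = mscale (-2) sl2_f"
  "bracket sl2_e sl2_f = sl2_h"
  by (rule sl2_eqI; (intro sl2_closed sl2_basis)?; simp add: bracket_def matrix_matrix_mult_def sum_2)+

text \<open>The module sees \<open>chi\<close> only through its values at \<open>sl2_h\<close> and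
  \<open>sl2_f\<close>; linearity turns their vanishing into the form in which the theorem expresses
  \<open>chi = 0\<close>.\<close>

lemma sl2_dual_zero:
  assumes "\<psi> \<in> sl2_dual" "\<psi> sl2_e = 0" "\<psi> sl2_f = 0" "\<psi> sl2_h = 0" "x \<in> sl2"
  shows "\<psi> x = 0"
  by (subst sl2_decompose[OF assms(5)])
    (use assms(1-4) in \<open>simp add: sl2_dual_def sl2_closed sl2_basis\<close>)

lemma Der_decompose:
  assumes "D \<in> Der M act" "x \<in> sl2"
  shows "D x = smult (x $ 1 $ 2) (D sl2_e) + smult (x $ 2 $ 1) (D sl2_f) + smult (x $ 1 $ 1) (D sl2_h)"
  by (subst sl2_decompose[OF assms(2)])
    (use assms(1) in \<open>simp add: Der_def sl2_closed sl2_basis\<close>)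

text \<open>The derivation law at [h,e] = 2e, [h,f] = -2f and [e,f] = h. Every use of the bracket
  below goes through these three relations.\<close>

lemma Der_basis:
  assumes "D \<in> Der M act"
  shows "smult 2 (D sl2_e) = act sl2_h (D sl2_e) - act sl2_e (D sl2_h)"
    and "smult (-2) (D sl2_f) = act sl2_h (D sl2_f) - act sl2_f (D sl2_h)"
    and "D sl2_h = act sl2_e (D sl2_f) - act sl2_f (D sl2_e)"
proof -
  have sc: "\<And>c x. x \<in> sl2 \<Longrightarrow> D (mscale c x) = smult c (D x)"
    and br: "\<And>x y. x \<in> sl2 \<Longrightarrow> y \<in> sl2 \<Longrightarrow> D (bracket x y) = act x (D y) - act y (D x)"
    using assms by (simp_all add: Der_def)
  show "smult 2 (D sl2_e) = act sl2_h (D sl2_e) - act sl2_e (D sl2_h)"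
    using br[of sl2_h sl2_e] by (simp only: bracket_basis sc sl2_basis)
  show "smult (-2) (D sl2_f) = act sl2_h (D sl2_f) - act sl2_f (D sl2_h)"
    using br[of sl2_h sl2_f] by (simp only: bracket_basis sc sl2_basis)
  show "D sl2_h = act sl2_e (D sl2_f) - act sl2_f (D sl2_e)"
    using br[of sl2_e sl2_f] by (simp only: bracket_basis sl2_basis)
qed

lemma Der_cong:
  assumes "D \<in> Der M act" "\<And>x. x \<in> sl2 \<Longrightarrow> \<phi> x = D x"
  shows "\<phi> \<in> Der M act"
  using assms by (simp add: Der_def sl2_closed)

lemma L_act_diff: "L_act chi l x (q - r) = L_act chi l x q - L_act chi l x r"
  using L_act_linear(3)[of chi l x q "smult (-1) r"] L_act_linear(4)[of chi l x "-1" r] by simp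

lemma L_act_0: "L_act chi l x 0 = 0"
  using L_act_diff[of chi l x 0 0] by simp

lemma Der_L_diff:
  assumes "D \<in> Der (L_carrier chi l) (L_act chi l)" "E \<in> Der (L_carrier chi l) (L_act chi l)"
  shows "(\<lambda>x. D x - E x) \<in> Der (L_carrier chi l) (L_act chi l)"
  using assms by (simp add: Der_def L_carrier_def L_act_diff smult_diff_right)

text \<open>A derivation realizing \<open>\<phi>\<close> at the pair \<open>x\<close>,
  \<open>y\<close> agrees with \<open>D0\<close> at \<open>y\<close>, so subtracting
  \<open>D0\<close> leaves one that vanishes there. It may depend on \<open>x\<close>.\<close>

lemma two_local_derivation_diff:
  assumes "two_local_derivation (L_carrier chi l) (L_act chi l) \<phi>"
    and "D0 \<in> Der (L_carrier chi l) (L_act chi l)"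
    and "x \<in> sl2" "y \<in> sl2" "\<phi> y = D0 y"
  obtains D where "D \<in> Der (L_carrier chi l) (L_act chi l)" "D y = 0" "\<phi> x - D0 x = D x"
proof -
  obtain E where "E \<in> Der (L_carrier chi l) (L_act chi l)" "\<phi> x = E x" "\<phi> y = E y"
    using assms unfolding two_local_derivation_def by blast
  with assms(5) show thesis by (intro that[OF Der_L_diff[OF _ assms(2)]]) simp_all
qed

lemma two_local_derivation_eq_Der:
  assumes tl: "two_local_derivation (L_carrier chi l) (L_act chi l) \<phi>" and y: "y \<in> sl2"
    and rigid: "\<And>D x. D \<in> Der (L_carrier chi l) (L_act chi l) \<Longrightarrow> D y = 0 \<Longrightarrow> x \<in> sl2 \<Longrightarrow> D x = 0"
  shows "\<phi> \<in> Der (L_carrier chi l) (L_act chi l)"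
proof -
  obtain D0 where D0: "D0 \<in> Der (L_carrier chi l) (L_act chi l)" "\<phi> y = D0 y"
    using tl y unfolding two_local_derivation_def by blast
  show ?thesis
  proof (rule Der_cong[OF D0(1)])
    fix x :: "'a ^ 2 ^ 2" assume x: "x \<in> sl2"
    obtain D where "D \<in> Der (L_carrier chi l) (L_act chi l)" "D y = 0" "\<phi> x - D0 x = D x"
      using two_local_derivation_diff[OF tl D0(1) x y D0(2)] .
    then show "\<phi> x = D0 x" using rigid[of D x] x by simp
  qed
qed

section \<open>Derivations vanishing at a basis element\<close>

context
  fixes chi :: "'a::field ^ 2 ^ 2 \<Rightarrow> 'a" and l :: 'a
  assumes p: "CHAR('a) > 2" and l: "l \<in> Lambda chi"
begin

private abbreviation (input) "DerL \<equiv> Der (L_carrier chi l) (L_act chi l)"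

private lemma p1: "CHAR('a) > 1"
  using p by simp

private lemma two_neq_0: "(2::'a) \<noteq> 0"
  using p of_nat_eq_0_iff_char_dvd[where 'a = 'a, of 2] by (auto dest: dvd_imp_le)

private lemma coeff_act:
  "coeff (L_act chi l sl2_e q) j =
     (if j + 1 < L_dim chi l then of_nat (j + 1) * (l - of_nat j) * coeff q (j + 1) else 0)"
  "coeff (L_act chi l sl2_h q) j = (if j < L_dim chi l then (l - 2 * of_nat j) * coeff q j else 0)"
  "coeff (L_act chi l sl2_f q) j = (if j < L_dim chi l then
     (if j = 0 then chi sl2_f ^ CHAR('a) * coeff q (L_dim chi l - 1) else coeff q (j - 1)) else 0)"
  by (simp_all add: coeff_L_act[OF L_dim(1)[OF p1 l]])

lemma Der_L_coeff_0:
  assumes "D \<in> DerL" "x \<in> sl2" "L_dim chi l \<le> j"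
  shows "coeff (D x) j = 0"
  using assms by (simp add: Der_def L_carrier_def)

lemma coeff_Der_decompose:
  assumes "D \<in> DerL" "x \<in> sl2"
  shows "coeff (D x) j = x $ 1 $ 2 * coeff (D sl2_e) j + x $ 2 $ 1 * coeff (D sl2_f) j
    + x $ 1 $ 1 * coeff (D sl2_h) j"
  by (subst Der_decompose[OF assms]) simp

text \<open>Here f shifts the basis cyclically up to a nonzero scalar, hence is injective. With D(f)
  = 0, the relation for [h,f] gives f D(h) = 0, and then the one for [e,f] gives f D(e) = 0.\<close>

lemma Der_f_0_rigid:
  assumes f: "chi sl2_f \<noteq> 0" and D: "D \<in> DerL" and Df: "D sl2_f = 0" and x: "x \<in> sl2"
  shows "D x = 0"
proof -
  have inj: "D y = 0" if y: "y \<in> sl2" and 0: "L_act chi l sl2_f (D y) = 0" for y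
  proof (rule poly_eqI)
    fix j
    have "coeff (L_act chi l sl2_f (D y)) 0 = 0" "coeff (L_act chi l sl2_f (D y)) (Suc j) = 0"
      by (simp_all add: 0)
    \<comment> \<open>The top coefficient is the one that wraps around to degree 0, scaled by
      \<open>chi(f)^p\<close>.\<close>
    moreover have "j = L_dim chi l - 1" if "\<not> Suc j < L_dim chi l" "\<not> L_dim chi l \<le> j"
      using that by linarith
    ultimately show "coeff (D y) j = coeff 0 j"
      using f Der_L_coeff_0[OF D y, of j] L_dim(1)[OF p1 l]
      by (cases "Suc j < L_dim chi l"; cases "L_dim chi l \<le> j") (auto simp: coeff_act)
  qed
  have h: "D sl2_h = 0"
    using inj[OF sl2_basis(1)] Der_basis(2)[OF D] by (simp add: Df L_act_0)
  have e: "D sl2_e = 0"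
    using inj[OF sl2_basis(2)] Der_basis(3)[OF D] by (simp add: Df h L_act_0)
  show ?thesis by (subst Der_decompose[OF D x]) (simp add: e h Df)
qed

text \<open>With D(h) = 0 the bracket relations say h D(e) = 2 D(e) and h D(f) = -2 D(f), whereas
  the basis vector of index \<open>j\<close> has weight \<open>l - 2j\<close>.\<close>

lemma Der_h_0:
  assumes D: "D \<in> DerL" and Dh: "D sl2_h = 0"
  shows "(l - 2 * of_nat j - 2) * coeff (D sl2_e) j = 0"
    and "(l - 2 * of_nat j + 2) * coeff (D sl2_f) j = 0"
proof -
  have "coeff (smult 2 (D sl2_e)) j = coeff (L_act chi l sl2_h (D sl2_e)) j"
    "coeff (smult (-2) (D sl2_f)) j = coeff (L_act chi l sl2_h (D sl2_f)) j"
    using Der_basis(1,2)[OF D] by (simp_all only: Dh L_act_0 diff_0_right)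
  then have "2 * coeff (D sl2_e) j = (l - 2 * of_nat j) * coeff (D sl2_e) j"
    "- 2 * coeff (D sl2_f) j = (l - 2 * of_nat j) * coeff (D sl2_f) j"
    using Der_L_coeff_0[OF D sl2_basis(2), of j] Der_L_coeff_0[OF D sl2_basis(3), of j]
    by (cases "j < L_dim chi l"; simp add: coeff_act)+
  then show "(l - 2 * of_nat j - 2) * coeff (D sl2_e) j = 0"
    "(l - 2 * of_nat j + 2) * coeff (D sl2_f) j = 0"
    by algebra+
qed

lemma Der_h_0_rigid:
  assumes w: "\<And>j. j < L_dim chi l \<Longrightarrow> l - 2 * of_nat j - 2 \<noteq> 0 \<and> l - 2 * of_nat j + 2 \<noteq> 0"
    and D: "D \<in> DerL" and Dh: "D sl2_h = 0" and x: "x \<in> sl2"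
  shows "D x = 0"
proof (rule poly_eqI)
  fix j
  show "coeff (D x) j = coeff 0 j"
  proof (cases "j < L_dim chi l")
    case True
    then have "coeff (D sl2_e) j = 0" "coeff (D sl2_f) j = 0"
      using Der_h_0[OF D Dh, of j] w by auto
    then show ?thesis by (simp add: coeff_Der_decompose[OF D x] Dh)
  qed (use Der_L_coeff_0[OF D x] in simp)
qed

text \<open>A weight equal to 2 or -2 would put \<open>l\<close> in the prime field, where
  \<open>l^p - l = 0\<close>, contrary to \<open>chi(h)^p \<noteq> 0\<close>.\<close>

lemma weights_generic:
  assumes h: "chi sl2_h \<noteq> 0"
  shows "l - 2 * of_nat j - 2 \<noteq> 0" "l - 2 * of_nat j + 2 \<noteq> 0"
proof -
  have l': "l \<noteq> of_nat n" for n
  proof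
    assume "l = of_nat n"
    then have "l ^ CHAR('a) = l" using power_CHAR_of_nat[where 'a = 'a, of n] p by simp
    then show False using l h by (simp add: Lambda_def)
  qed
  show "l - 2 * of_nat j - 2 \<noteq> 0" using l'[of "2 * j + 2"] by (auto simp: algebra_simps)
  \<comment> \<open>Replacing -2 by \<open>p - 2\<close> writes \<open>2j - 2\<close> as the image
    of a natural number even for \<open>j = 0\<close>.\<close>
  have "of_nat (CHAR('a) - 2) = (- 2 :: 'a)" using p by (simp add: of_nat_diff)
  then show "l - 2 * of_nat j + 2 \<noteq> 0" using l'[of "2 * j + (CHAR('a) - 2)"]
    by (auto simp: algebra_simps add_eq_0_iff)
qed

section \<open>The case \<open>chi = 0\<close>: modules with basis
  \<open>v\<^sub>0, ..., v\<^sub>N\<close>\<close>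

context
  fixes N
  assumes h0: "chi sl2_h = 0" and f0: "chi sl2_f = 0" and N: "N = Phi l"
begin

private lemma l_eq: "l = of_nat N" "N < CHAR('a)" "L_dim chi l = Suc N"
proof -
  have "l ^ CHAR('a) = l" using l p h0 by (simp add: Lambda_def power_0_left)
  from Phi[OF p1 this] show "l = of_nat N" "N < CHAR('a)" by (simp_all add: N)
  show "L_dim chi l = Suc N" by (simp add: L_dim_def h0 f0 N)
qed

text \<open>Both factors are images of integers between 1 and \<open>p - 1\<close>, namely
  \<open>j + 1\<close> and \<open>N - j\<close>. Hence the kernel of e is spanned by
  \<open>v\<^sub>0\<close>.\<close>

private lemma raise_neq_0:
  assumes "j < N"
  shows "of_nat (Suc j) * (l - of_nat j) \<noteq> 0"
proof -
  have "of_nat n \<noteq> (0::'a)" if "0 < n" "n < CHAR('a)" for n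
    using of_nat_inj_CHAR[where 'a = 'a, of n 0] that by auto
  from this[of "Suc j"] this[of "N - j"]
  have "of_nat (Suc j) \<noteq> (0::'a)" "of_nat (N - j) \<noteq> (0::'a)"
    using assms l_eq(2) by linarith+
  then show ?thesis using assms by (simp add: l_eq(1) of_nat_diff)
qed

text \<open>The relation for [h,e] becomes e D(h) = 0, so D(h) is a multiple of
  \<open>v\<^sub>0\<close>. Then e D(f) = D(h) confines D(f) to the span of \<open>v\<^sub>0\<close>
  and \<open>v\<^sub>1\<close>.\<close>

lemma Der_e_0:
  assumes D: "D \<in> DerL" and De: "D sl2_e = 0"
  shows "0 < j \<Longrightarrow> coeff (D sl2_h) j = 0" and "1 < j \<Longrightarrow> coeff (D sl2_f) j = 0"
proof -
  have hj: "coeff (D sl2_h) (Suc i) = 0" for i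
  proof (cases "i < N")
    case True
    have "L_act chi l sl2_e (D sl2_h) = 0" using Der_basis(1)[OF D] by (simp add: De L_act_0)
    then have "coeff (L_act chi l sl2_e (D sl2_h)) i = 0" by simp
    then show ?thesis using True raise_neq_0[OF True] by (simp add: coeff_act l_eq(3))
  next
    case False
    then show ?thesis using Der_L_coeff_0[OF D sl2_basis(1), of "Suc i"] by (simp add: l_eq(3))
  qed
  have fj: "coeff (D sl2_f) (Suc (Suc i)) = 0" for i
  proof (cases "Suc i < N")
    case True
    have "D sl2_h = L_act chi l sl2_e (D sl2_f)" using Der_basis(3)[OF D] by (simp add: De L_act_0)
    then have "coeff (L_act chi l sl2_e (D sl2_f)) (Suc i) = 0" by (metis hj)
    then show ?thesis using True raise_neq_0[OF True] by (simp add: coeff_act l_eq(3))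
  next
    case False
    then show ?thesis using Der_L_coeff_0[OF D sl2_basis(3), of "Suc (Suc i)"] by (simp add: l_eq(3))
  qed
  show "0 < j \<Longrightarrow> coeff (D sl2_h) j = 0" using hj[of "j - 1"] by simp
  show "1 < j \<Longrightarrow> coeff (D sl2_f) j = 0" using fj[of "j - 2"] by (simp add: numeral_2_eq_2 Suc_diff_Suc)
qed

text \<open>The mirror image at the other end of the basis: the kernel of f is spanned by
  \<open>v\<^sub>N\<close>, which contains D(h), and f D(e) = -D(h).\<close>

lemma Der_f_0:
  assumes D: "D \<in> DerL" and Df: "D sl2_f = 0"
  shows "j < N \<Longrightarrow> coeff (D sl2_h) j = 0" and "Suc j < N \<Longrightarrow> coeff (D sl2_e) j = 0"
proof -
  have hj: "coeff (D sl2_h) i = 0" if "i < N" for i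
  proof -
    have "L_act chi l sl2_f (D sl2_h) = 0" using Der_basis(2)[OF D] by (simp add: Df L_act_0)
    then have "coeff (L_act chi l sl2_f (D sl2_h)) (Suc i) = 0" by simp
    then show ?thesis using that by (simp add: coeff_act l_eq(3))
  qed
  show "j < N \<Longrightarrow> coeff (D sl2_h) j = 0" by (rule hj)
  have "D sl2_h = - L_act chi l sl2_f (D sl2_e)" using Der_basis(3)[OF D] by (simp add: Df L_act_0)
  then have "coeff (D sl2_h) (Suc j) = - coeff (L_act chi l sl2_f (D sl2_e)) (Suc j)"
    by (metis coeff_minus)
  then show "coeff (D sl2_e) j = 0" if "Suc j < N"
    using hj[OF that] that by (simp add: coeff_act l_eq(3))
qed

section \<open>Comparison of \<open>\<phi>\<close> with a derivation \<open>D0\<close> that agrees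
  with it at e and f\<close>

context
  fixes \<phi> D0
  assumes tl: "two_local_derivation (L_carrier chi l) (L_act chi l) \<phi>"
    and D0: "D0 \<in> DerL" "\<phi> sl2_e = D0 sl2_e" "\<phi> sl2_f = D0 sl2_f"
begin

lemma two_local_e:
  assumes x: "x \<in> sl2"
  shows "1 < j \<Longrightarrow> coeff (\<phi> x - D0 x) j = 0"
    and "x $ 2 $ 1 = 0 \<Longrightarrow> 0 < j \<Longrightarrow> coeff (\<phi> x - D0 x) j = 0"
proof -
  obtain D where D: "D \<in> DerL" "D sl2_e = 0" "\<phi> x - D0 x = D x"
    using two_local_derivation_diff[OF tl D0(1) x sl2_basis(2) D0(2)] .
  show "1 < j \<Longrightarrow> coeff (\<phi> x - D0 x) j = 0"
    and "x $ 2 $ 1 = 0 \<Longrightarrow> 0 < j \<Longrightarrow> coeff (\<phi> x - D0 x) j = 0"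
    by (simp_all add: D(2,3) coeff_Der_decompose[OF D(1) x] Der_e_0[OF D(1,2)])
qed

lemma two_local_f:
  assumes x: "x \<in> sl2"
  shows "Suc j < N \<Longrightarrow> coeff (\<phi> x - D0 x) j = 0"
    and "x $ 1 $ 2 = 0 \<Longrightarrow> j < N \<Longrightarrow> coeff (\<phi> x - D0 x) j = 0"
proof -
  obtain D where D: "D \<in> DerL" "D sl2_f = 0" "\<phi> x - D0 x = D x"
    using two_local_derivation_diff[OF tl D0(1) x sl2_basis(3) D0(3)] .
  show "Suc j < N \<Longrightarrow> coeff (\<phi> x - D0 x) j = 0"
    and "x $ 1 $ 2 = 0 \<Longrightarrow> j < N \<Longrightarrow> coeff (\<phi> x - D0 x) j = 0"
    by (simp_all add: D(2,3) coeff_Der_decompose[OF D(1) x] Der_f_0[OF D(1,2)])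
qed

text \<open>As h has neither an e- nor an f-component, the difference is a multiple of
  \<open>v\<^sub>0\<close> by comparison at e and of \<open>v\<^sub>N\<close> by comparison at
  f.\<close>

lemma two_local_h:
  assumes "0 < N"
  shows "\<phi> sl2_h = D0 sl2_h"
proof -
  have "coeff (\<phi> sl2_h - D0 sl2_h) j = 0" for j
    using two_local_e(2)[of sl2_h j] two_local_f(2)[of sl2_h j] assms
    by (cases "j = 0") (auto simp: sl2_basis)
  then have "\<phi> sl2_h - D0 sl2_h = 0" by (intro poly_eqI) simp
  then show ?thesis by simp
qed

text \<open>Agreement at h allows a third comparison, now with a derivation vanishing at h, whose
  values at e and f have weights 2 and -2.\<close>

lemma two_local_weights:
  assumes "0 < N" and x: "x \<in> sl2"
    and "x $ 1 $ 2 = 0 \<or> l - 2 * of_nat j - 2 \<noteq> 0"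
    and "x $ 2 $ 1 = 0 \<or> l - 2 * of_nat j + 2 \<noteq> 0"
  shows "coeff (\<phi> x - D0 x) j = 0"
proof -
  obtain D where D: "D \<in> DerL" "D sl2_h = 0" "\<phi> x - D0 x = D x"
    using two_local_derivation_diff[OF tl D0(1) x sl2_basis(1) two_local_h[OF assms(1)]] .
  show ?thesis unfolding D(3) coeff_Der_decompose[OF D(1) x]
    using assms(3,4) Der_h_0[OF D(1,2), of j] by (auto simp: D(2))
qed

lemma two_local_ge_2:
  assumes "2 \<le> N" and x: "x \<in> sl2"
  shows "\<phi> x = D0 x"
proof -
  have "coeff (\<phi> x - D0 x) j = 0" for j
  proof -
    \<comment> \<open>Comparison at e and at f settles every index except \<open>j = 1\<close> for
      \<open>N = 2\<close>, where \<open>v\<^sub>1\<close> has weight 0, different from 2 and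
      -2.\<close>
    consider "1 < j" | "Suc j < N" | "j = 1" "N = 2" using assms(1) by linarith
    then show ?thesis
    proof cases
      case 3
      have "l = 2" using l_eq(1) 3 by simp
      then show ?thesis using 3 two_neq_0 by (intro two_local_weights x) auto
    qed (use two_local_e(1)[OF x] two_local_f(1)[OF x] in auto)
  qed
  then have "\<phi> x - D0 x = 0" by (intro poly_eqI) simp
  then show ?thesis by simp
qed

text \<open>If the f-component of \<open>x\<close> is 0, comparison at e removes
  \<open>v\<^sub>1\<close>, and \<open>v\<^sub>0\<close> has weight 1, not 2; dually if the
  e-component is 0. With both present the weights no longer suffice when \<open>p = 3\<close>, since
  then 1 = -2.\<close>

lemma two_local_exceptional:
  assumes "N = 1" and x: "x \<in> sl2" and "x $ 1 $ 2 * x $ 2 $ 1 = 0"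
  shows "\<phi> x = D0 x"
proof -
  have l1: "l = 1" using l_eq(1) assms(1) by simp
  have "coeff (\<phi> x - D0 x) j = 0" for j
  proof -
    consider "1 < j" | "j = 0" "x $ 1 $ 2 = 0" | "j = 0" "x $ 2 $ 1 = 0"
      | "j = 1" "x $ 1 $ 2 = 0" | "j = 1" "x $ 2 $ 1 = 0"
      using assms(3) by (cases "1 < j"; cases "j = 0") auto
    then show ?thesis
    proof cases
      case 3
      then show ?thesis using assms(1) by (intro two_local_weights x) (auto simp: l1)
    next
      case 4
      then show ?thesis using assms(1) by (intro two_local_weights x) (auto simp: l1)
    qed (use assms(1) two_local_e[OF x] two_local_f[OF x] in auto)
  qed
  then have "\<phi> x - D0 x = 0" by (intro poly_eqI) simp
  then show ?thesis by simp
qed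

end

text \<open>The action is zero, so derivations kill all brackets, and these span \<open>sl2\<close>
  because 2 is invertible.\<close>

lemma Der_trivial_module:
  assumes "N = 0" "D \<in> DerL" "x \<in> sl2"
  shows "D x = 0"
proof (rule poly_eqI)
  fix j
  have l0: "l = 0" and d: "L_dim chi l = 1" using l_eq assms(1) by simp_all
  have act: "L_act chi l y (D z) = 0" if "z \<in> sl2" for y z
  proof (rule poly_eqI)
    fix i
    show "coeff (L_act chi l y (D z)) i = coeff 0 i"
      unfolding coeff_L_act[OF L_dim(1)[OF p1 l]] d f0 using p by (simp add: l0 power_0_left)
  qed
  have "smult 2 (D sl2_e) = 0" "smult (-2) (D sl2_f) = 0" "D sl2_h = 0"
    using Der_basis[OF assms(2)] by (simp_all only: act[OF sl2_basis(1)] act[OF sl2_basis(2)]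
      act[OF sl2_basis(3)] L_act_0 diff_self)
  then have "D sl2_e = 0" "D sl2_f = 0" "D sl2_h = 0" using two_neq_0 by simp_all
  then show "coeff (D x) j = coeff 0 j" by (simp add: coeff_Der_decompose[OF assms(2,3)])
qed

text \<open>The weights 1 and -1 differ from 2 and -2 by 1 or 3 up to sign, so only
  \<open>p = 3\<close> could make them meet.\<close>

lemma weights_natural:
  assumes "N = 1" "CHAR('a) \<noteq> 3" "j < L_dim chi l"
  shows "l - 2 * of_nat j - 2 \<noteq> 0 \<and> l - 2 * of_nat j + 2 \<noteq> 0"
proof -
  have "(3::'a) \<noteq> 0"
  proof
    assume "(3::'a) = 0"
    then have "CHAR('a) dvd 3" using of_nat_eq_0_iff_char_dvd[where 'a = 'a, of 3] by simp
    then have "CHAR('a) \<le> 3" by (rule dvd_imp_le) simp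
    with p assms(2) show False by simp
  qed
  moreover have "j = 0 \<or> j = 1" using assms l_eq(3) by auto
  then have "l - 2 * of_nat j - 2 = (if j = 0 then -1 else -3)"
    "l - 2 * of_nat j + 2 = (if j = 0 then 3 else 1)"
    using l_eq(1) assms(1) by auto
  ultimately show ?thesis by simp
qed

end

end

theorem theorem3p4:
  fixes chi :: "'a::field ^ 2 ^ 2 \<Rightarrow> 'a"
    and l :: 'a
    and \<phi> :: "'a ^ 2 ^ 2 \<Rightarrow> 'a poly"
  assumes "CHAR('a) > 2"
    and "chi \<in> sl2_dual" and "chi sl2_e = 0"
    and "l \<in> Lambda chi"
    and "two_local_derivation (L_carrier chi l) (L_act chi l) \<phi>"
  shows "(\<not> ((\<forall>x\<in>sl2. chi x = 0) \<and> CHAR('a) = 3 \<and> l = 1) \<longrightarrow>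
            \<phi> \<in> Der (L_carrier chi l) (L_act chi l)) \<and>
         ((\<forall>x\<in>sl2. chi x = 0) \<and> CHAR('a) = 3 \<and> l = 1 \<longrightarrow>
            (\<exists>D\<in>Der (L_carrier chi l) (L_act chi l). \<exists>m n :: 'a ^ 2 ^ 2 \<Rightarrow> 'a.
               \<forall>xe xf xh. let x = mscale xe sl2_e + mscale xf sl2_f + mscale xh sl2_h in
                 \<phi> x = D x + (if xe * xf = 0 then 0
                               else smult (m x) (L_basis 0) + smult (n x) (L_basis 1))))"
proof (intro conjI impI)
  note p = assms(1) and l = assms(4) and tl = assms(5)
  assume ne: "\<not> ((\<forall>x\<in>sl2. chi x = 0) \<and> CHAR('a) = 3 \<and> l = 1)"
  consider "chi sl2_f \<noteq> 0" | "chi sl2_h \<noteq> 0" | "chi sl2_f = 0" "chi sl2_h = 0" by blast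
  then show "\<phi> \<in> Der (L_carrier chi l) (L_act chi l)"
  proof cases
    case 1
    show ?thesis
      by (rule two_local_derivation_eq_Der[OF tl sl2_basis(3)]) (rule Der_f_0_rigid[OF p l 1])
  next
    case 2
    show ?thesis
      by (rule two_local_derivation_eq_Der[OF tl sl2_basis(1)])
        (rule Der_h_0_rigid[OF p l], use weights_generic[OF p l 2] in blast)
  next
    case 3
    consider "Phi l = 0" | "Phi l = 1" | "2 \<le> Phi l" by linarith
    then show ?thesis
    proof cases
      case N: 1
      show ?thesis
        by (rule two_local_derivation_eq_Der[OF tl sl2_basis(1)])
          (rule Der_trivial_module[OF p l 3(2,1) refl N])
    next
      case N: 2
      have "l ^ CHAR('a) = l" using l p 3 by (simp add: Lambda_def power_0_left)
      then have "l = 1" using Phi(2)[of l] p N by simp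
      moreover have "\<forall>x\<in>sl2. chi x = 0" using sl2_dual_zero[OF assms(2,3) 3] by blast
      ultimately have "CHAR('a) \<noteq> 3" using ne by blast
      show ?thesis
        by (rule two_local_derivation_eq_Der[OF tl sl2_basis(1)])
          (rule Der_h_0_rigid[OF p l weights_natural[OF p l 3(2,1) refl N \<open>CHAR('a) \<noteq> 3\<close>]])
    next
      case N: 3
      obtain D0 where D0: "D0 \<in> Der (L_carrier chi l) (L_act chi l)"
        "\<phi> sl2_e = D0 sl2_e" "\<phi> sl2_f = D0 sl2_f"
        using tl sl2_basis unfolding two_local_derivation_def by blast
      show ?thesis
        by (rule Der_cong[OF D0(1)]) (rule two_local_ge_2[OF p l 3(2,1) refl tl D0 N])
    qed
  qed
next
  note p = assms(1) and l = assms(4) and tl = assms(5)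
  assume exc: "(\<forall>x\<in>sl2. chi x = 0) \<and> CHAR('a) = 3 \<and> l = 1"
  then have hf: "chi sl2_h = 0" "chi sl2_f = 0" by (simp_all add: sl2_basis)
  have "l ^ CHAR('a) = l" using exc by simp
  with Phi[of l] p have "Phi l < CHAR('a)" "of_nat (Phi l) = l" by simp_all
  then have N: "Phi l = 1" using of_nat_inj_CHAR[where 'a = 'a, of "Phi l" 1] exc p by simp
  have d: "L_dim chi l = 2" by (simp add: L_dim_def hf N)
  obtain D0 where D0: "D0 \<in> Der (L_carrier chi l) (L_act chi l)"
    "\<phi> sl2_e = D0 sl2_e" "\<phi> sl2_f = D0 sl2_f"
    using tl sl2_basis unfolding two_local_derivation_def by blast
  note eq = two_local_exceptional[OF p l hf refl tl D0 N]
  define m where "m x = coeff (\<phi> x - D0 x) 0" for x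
  define n where "n x = coeff (\<phi> x - D0 x) 1" for x
  have mn: "\<phi> x = D0 x + (smult (m x) (L_basis 0) + smult (n x) (L_basis 1))" if "x \<in> sl2" for x
  proof -
    have "\<phi> x \<in> L_carrier chi l" "D0 x \<in> L_carrier chi l"
      using that tl D0(1) by (simp_all add: two_local_derivation_def Der_def)
    then have "coeff (\<phi> x) j = 0" "coeff (D0 x) j = 0" if "j \<ge> 2" for j
      using that by (simp_all add: L_carrier_def d)
    then have "coeff (\<phi> x) j = coeff (D0 x + (smult (m x) (L_basis 0) + smult (n x) (L_basis 1))) j"
      for j
      by (cases "j = 0 \<or> j = 1") (auto simp: m_def n_def L_basis_def coeff_pCons split: nat.split)
    then show ?thesis by (rule poly_eqI)
  qed
  have "let x = mscale xe sl2_e + mscale xf sl2_f + mscale xh sl2_h in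
      \<phi> x = D0 x + (if xe * xf = 0 then 0
        else smult (m x) (L_basis 0) + smult (n x) (L_basis 1))" for xe xf xh
  proof -
    have "mscale xe sl2_e + mscale xf sl2_f + mscale xh sl2_h \<in> sl2"
      by (intro sl2_closed sl2_basis)
    from eq[OF this] mn[OF this] show ?thesis by (simp add: Let_def)
  qed
  with D0(1) show "\<exists>D\<in>Der (L_carrier chi l) (L_act chi l). \<exists>m n :: 'a ^ 2 ^ 2 \<Rightarrow> 'a.
      \<forall>xe xf xh. let x = mscale xe sl2_e + mscale xf sl2_f + mscale xh sl2_h in
        \<phi> x = D x + (if xe * xf = 0 then 0
          else smult (m x) (L_basis 0) + smult (n x) (L_basis 1))"
    by blast
qed

end
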